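(* Every irreducible congruence representation $\pi$ of $\Gamma_\theta$ is contained, as an irreducible direct summand, in the restriction $R|_{\Gamma_\theta}$ of some irreducible congruence representation $R$ of $\mathrm{SL}_2(\mathbb{Z})$.
   Context: Representations are finite-dimensional and complex. $\Gamma_\theta$ is the subgroup of $\mathrm{SL}_2(\mathbb{Z})$ generated by $s=\begin{pmatrix}0&-1\\1&0\end{pmatrix}$ and $t^2=\begin{pmatrix}1&2\\0&1\end{pmatrix}$; it has index 3 in $\mathrm{SL}_2(\mathbb{Z})$ and contains $\Gamma(2)$. $\Gamma(n)$ is the principal congruence subgroup of level $n$, i.e. the kernel of $\mathrm{SL}_2(\mathbb{Z})\to\mathrm{SL}_2(\mathbb{Z}/n)$. A representation of $\mathrm{SL}_2(\mathbb{Z})$ or of $\Gamma_\theta$ is called congruence if its kernel contains $\Gamma(n)$ for some positive integer $n$. *)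

theory Defs
  imports "HOL-Algebra.Generated_Groups" "HOL-Algebra.Coset" "Jordan_Normal_Form.VS_Connect"
begin

definition SL2Z :: "int mat monoid" where
  "SL2Z = \<lparr>carrier = {A \<in> carrier_mat 2 2. det A = 1}, monoid.mult = (*), one = 1\<^sub>m 2\<rparr>"

text \<open>Reducing the entries modulo \<open>N\<close> realises the map to \<open>SL\<^sub>2(\<int>/N)\<close>.\<close>

definition Gamma :: "nat \<Rightarrow> int mat set" where
  "Gamma N = {A \<in> carrier SL2Z.
     map_mat (\<lambda>a. a mod int N) A = map_mat (\<lambda>a. a mod int N) (1\<^sub>m 2)}"

definition Gamma_theta :: "int mat set" where
  "Gamma_theta = generate SL2Z
     {mat_of_rows_list 2 [[0, -1], [1, 0]], mat_of_rows_list 2 [[1, 2], [0, 1]]}"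

definition Gamma_theta_group :: "int mat monoid" where
  "Gamma_theta_group = SL2Z\<lparr>carrier := Gamma_theta\<rparr>"

definition GL :: "nat \<Rightarrow> complex mat monoid" where
  "GL n = units_of (ring_mat TYPE(complex) n ())"

text \<open>A representation of dimension \<open>n\<close> acts on \<open>\<complex>\<^sup>n\<close>; its values outside \<open>carrier G\<close> are irrelevant.\<close>

definition is_rep :: "('g, 'b) monoid_scheme \<Rightarrow> nat \<Rightarrow> ('g \<Rightarrow> complex mat) \<Rightarrow> bool" where
  "is_rep G n \<rho> \<longleftrightarrow> \<rho> \<in> hom G (GL n)"

definition invariant_subspace ::
  "('g, 'b) monoid_scheme \<Rightarrow> nat \<Rightarrow> ('g \<Rightarrow> complex mat) \<Rightarrow> complex vec set \<Rightarrow> bool" where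
  "invariant_subspace G n \<rho> W \<longleftrightarrow>
     VectorSpace.subspace class_ring W (module_vec TYPE(complex) n) \<and>
     (\<forall>g \<in> carrier G. \<forall>w \<in> W. \<rho> g *\<^sub>v w \<in> W)"

definition irreducible_rep ::
  "('g, 'b) monoid_scheme \<Rightarrow> nat \<Rightarrow> ('g \<Rightarrow> complex mat) \<Rightarrow> bool" where
  "irreducible_rep G n \<rho> \<longleftrightarrow> is_rep G n \<rho> \<and> n \<noteq> 0 \<and>
     (\<forall>W. invariant_subspace G n \<rho> W \<longrightarrow> W = {0\<^sub>v n} \<or> W = carrier_vec n)"

definition congruence_rep ::
  "(int mat, 'b) monoid_scheme \<Rightarrow> nat \<Rightarrow> (int mat \<Rightarrow> complex mat) \<Rightarrow> bool" where
  "congruence_rep G n \<rho> \<longleftrightarrow> is_rep G n \<rho> \<and> (\<exists>N>0. Gamma N \<subseteq> kernel G (GL n) \<rho>)"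

definition equivalent_reps ::
  "('g, 'b) monoid_scheme \<Rightarrow> nat \<Rightarrow> ('g \<Rightarrow> complex mat) \<Rightarrow> ('g \<Rightarrow> complex mat) \<Rightarrow> bool" where
  "equivalent_reps G n \<rho> \<sigma> \<longleftrightarrow> (\<exists>P \<in> carrier (GL n). \<forall>g \<in> carrier G. P * \<rho> g = \<sigma> g * P)"

definition direct_sum_rep ::
  "nat \<Rightarrow> ('g \<Rightarrow> complex mat) \<Rightarrow> nat \<Rightarrow> ('g \<Rightarrow> complex mat) \<Rightarrow> 'g \<Rightarrow> complex mat" where
  "direct_sum_rep m \<rho> n \<sigma> g = four_block_mat (\<rho> g) (0\<^sub>m m n) (0\<^sub>m n m) (\<sigma> g)"

text \<open>The complement \<open>\<sigma>\<close> may have dimension 0.\<close>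

definition direct_summand ::
  "('g, 'b) monoid_scheme \<Rightarrow> nat \<Rightarrow> ('g \<Rightarrow> complex mat) \<Rightarrow> nat \<Rightarrow> ('g \<Rightarrow> complex mat) \<Rightarrow> bool" where
  "direct_summand G m \<rho> n \<tau> \<longleftrightarrow>
     (\<exists>k \<sigma>. n = m + k \<and> is_rep G k \<sigma> \<and> equivalent_reps G n \<tau> (direct_sum_rep m \<rho> k \<sigma>))"

end

(* Frobenius reciprocity in matrix form. Consider the representations of SL2(Z), trivial on
   Gamma(N), that carry a nonzero Gamma_theta-equivariant map Phi to pi. The regular representation
   of SL2(Z)/Gamma(N) is one. One of minimal dimension is irreducible: an invariant subspace gives
   a smaller subrepresentation and a smaller quotient, and either Phi is nonzero on the first or it
   factors through the second. As pi is irreducible, Phi is surjective, and averaging a right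
   inverse of Phi over the finite group Gamma_theta/Gamma(N) splits it. *)

theory Submission
  imports Defs
begin

subsection \<open>Subspaces and their complements as matrix pairs\<close>

text \<open>A representation is a matrix-valued function, so an invariant subspace carries one only
  after a choice of basis. Each subspace is therefore encoded by a pair \<open>B\<close>,
  \<open>L\<close> with \<open>L * B\<close> the identity; the restriction to it and the quotient by
  a complementary one both become compressions \<open>L * \<rho> g * B\<close>, to which minimality
  of the dimension can be applied. Triviality on Gamma(N) is part of the minimised property and
  survives compression, since \<open>L * 1 * B\<close> is again the identity: this is what makes R a
  congruence representation. The finite quotient is handled through numbered cosets and chosen
  representatives. The numbers serve as matrix indices in the regular representation and as the
  summation range of the average. The nonzero map out of the regular representation sends the basis
  vector of the coset of x to \<pi>(x) applied to the first unit vector if x lies in Gamma_theta,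
  and to 0 otherwise. It depends on the coset alone because Gamma(N) lies in Gamma_theta and acts
  trivially under \<pi>; both facts are contained in the congruence hypothesis.\<close>

lemma assoc_mat:
  fixes A B C :: "'a :: semiring_0 mat"
  assumes "dim_col A = dim_row B" and "dim_col B = dim_row C"
  shows "A * B * C = A * (B * C)"
  by (rule assoc_mult_mat[of A "dim_row A" "dim_row B" B "dim_row C" C "dim_col C"])
    (use assms in auto)

lemma left_inverse_cancel:
  fixes L B X :: "'a :: semiring_1 mat"
  assumes "L * B = 1\<^sub>m k" and "dim_col L = dim_row B" and "dim_col B = dim_row X" and "dim_row X = k"
  shows "L * (B * X) = X"
proof -
  have "L * (B * X) = L * B * X" by (rule assoc_mat[symmetric]) (use assms in auto)
  also have "\<dots> = X" unfolding assms(1) by (rule left_mult_one_mat) (use assms in auto)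
  finally show ?thesis .
qed

text \<open>If \<open>m < k\<close>, padding with zeros gives square matrices that are still inverse
  on one side, hence on both; but the padded \<open>B'\<close> has a zero row.\<close>

lemma left_inverse_dim_le:
  fixes L B :: "'a :: field mat"
  assumes L: "L \<in> carrier_mat k m" and B: "B \<in> carrier_mat m k" and LB: "L * B = 1\<^sub>m k"
  shows "k \<le> m"
proof (rule ccontr)
  assume "\<not> k \<le> m"
  then have mk: "m < k" by simp
  define B' where "B' = four_block_mat B (0\<^sub>m m 0) (0\<^sub>m (k - m) k) (0\<^sub>m (k - m) 0)"
  define L' where "L' = four_block_mat L (0\<^sub>m k (k - m)) (0\<^sub>m 0 m) (0\<^sub>m 0 (k - m))"
  have B': "B' \<in> carrier_mat k k" using mk B unfolding B'_def by auto
  have L': "L' \<in> carrier_mat k k" using mk L unfolding L'_def by auto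
  have "L' * B' = 1\<^sub>m k"
    unfolding L'_def B'_def
    by (subst mult_four_block_mat[of _ k m _ "k - m" _ 0 _ _ k _ 0]) (use L B LB in auto)
  then have "B' * L' = 1\<^sub>m k" by (rule mat_mult_left_right_inverse[OF L' B'])
  then have "(B' * L') $$ (k - 1, k - 1) = 1" using mk by simp
  moreover have "row B' (k - 1) = 0\<^sub>v k"
    using mk B by (intro eq_vecI) (auto simp: B'_def)
  ultimately show False using B' L' mk by auto
qed

text \<open>\<open>B * L\<close> is the projection onto the column space of \<open>B\<close> along
  the kernel of \<open>L\<close>, so \<open>E\<close> is the complementary projection, onto the
  kernel of \<open>L\<close>.\<close>

lemma complement_projection:
  fixes B L :: "'a :: field mat"
  assumes B: "B \<in> carrier_mat m k" and L: "L \<in> carrier_mat k m" and LB: "L * B = 1\<^sub>m k"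
  defines "E \<equiv> 1\<^sub>m m - B * L"
  shows "E \<in> carrier_mat m m" "L * E = 0\<^sub>m k m" "E * B = 0\<^sub>m m k" "E * E = E"
proof -
  note dims = carrier_matD[OF B] carrier_matD[OF L]
  have BL: "B * L \<in> carrier_mat m m" using B L by simp
  show E: "E \<in> carrier_mat m m" unfolding E_def using BL by (rule minus_carrier_mat)
  have LBL: "L * (B * L) = L" by (rule left_inverse_cancel[OF LB]) (simp_all add: dims)
  have BLB: "B * L * B = B" using B by (simp add: assoc_mat dims LB)
  show LE: "L * E = 0\<^sub>m k m" unfolding E_def
    using B L LBL by (subst mult_minus_distrib_mat[of _ k m _ m]) auto
  show "E * B = 0\<^sub>m m k" unfolding E_def
    using B L BLB by (subst minus_mult_distrib_mat[of _ m m _ _ k]) (auto simp: dims)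
  have "B * L * E = 0\<^sub>m m m" using E B by (simp add: assoc_mat dims LE)
  moreover have "E * E = 1\<^sub>m m * E - B * L * E"
    using minus_mult_distrib_mat[OF one_carrier_mat BL E] unfolding E_def[symmetric] .
  ultimately show "E * E = E" using E by (intro eq_matI) auto
qed

lemma subspace_iff:
  "VectorSpace.subspace class_ring W (module_vec TYPE('a :: field) n) \<longleftrightarrow>
     W \<subseteq> carrier_vec n \<and> 0\<^sub>v n \<in> W \<and> (\<forall>v \<in> W. \<forall>w \<in> W. v + w \<in> W) \<and> (\<forall>c. \<forall>v \<in> W. c \<cdot>\<^sub>v v \<in> W)"
  using vec_vs vec_module
  by (auto simp: VectorSpace.subspace_def submodule_def module_vec_simps)

text \<open>A subspace is encoded by a matrix \<open>B\<close> whose columns form a basis, together with a left inverse.\<close>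

lemma subspace_basis_matrix:
  fixes W :: "'a :: field vec set"
  assumes "VectorSpace.subspace class_ring W (module_vec TYPE('a) m)"
  obtains k B L where "B \<in> carrier_mat m k" "L \<in> carrier_mat k m" "L * B = 1\<^sub>m k"
    "W = (\<lambda>x. B *\<^sub>v x) ` carrier_vec k"
proof -
  have W: "W \<subseteq> carrier_vec m" and W0: "0\<^sub>v m \<in> W"
    and Wadd: "\<And>v w. v \<in> W \<Longrightarrow> w \<in> W \<Longrightarrow> v + w \<in> W"
    and Wsm: "\<And>c v. v \<in> W \<Longrightarrow> c \<cdot>\<^sub>v v \<in> W"
    using assms unfolding subspace_iff by auto
  \<comment> \<open>\<open>Q k\<close> says that \<open>W\<close> contains \<open>k\<close>
    independent vectors, independence being witnessed by the left inverse. A largest such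
    \<open>k\<close> exists by the dimension bound, and its columns must span
    \<open>W\<close>.\<close>
  define Q where "Q k \<longleftrightarrow> (\<exists>B L. B \<in> carrier_mat m k \<and> L \<in> carrier_mat k m \<and> L * B = 1\<^sub>m k \<and>
      (\<lambda>x. B *\<^sub>v x) ` carrier_vec k \<subseteq> W)" for k
  have "0\<^sub>m m 0 *\<^sub>v x = 0\<^sub>v m" if "x \<in> carrier_vec 0" for x :: "'a vec"
    using that by (intro eq_vecI) (auto simp: scalar_prod_def)
  then have "Q 0" unfolding Q_def
    by (intro exI[of _ "0\<^sub>m m 0"] exI[of _ "0\<^sub>m 0 m"]) (auto simp: W0)
  moreover have bound: "\<forall>k. Q k \<longrightarrow> k \<le> m" unfolding Q_def using left_inverse_dim_le by blast
  ultimately have "Q (Greatest Q)" using GreatestI_nat[of Q 0 m] by blast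
  define k where "k = Greatest Q"
  have max: "\<not> Q (k + 1)" using bound Greatest_le_nat[of Q "k + 1" m] by (auto simp: k_def)
  from \<open>Q (Greatest Q)\<close> obtain B L where B: "B \<in> carrier_mat m k" and L: "L \<in> carrier_mat k m"
    and LB: "L * B = 1\<^sub>m k" and sub: "(\<lambda>x. B *\<^sub>v x) ` carrier_vec k \<subseteq> W"
    unfolding Q_def k_def by blast
  have "u \<in> (\<lambda>x. B *\<^sub>v x) ` carrier_vec k" if u: "u \<in> W" for u
  proof (rule ccontr)
    assume notin: "u \<notin> (\<lambda>x. B *\<^sub>v x) ` carrier_vec k"
    have uc: "u \<in> carrier_vec m" using u W by blast
    define E where "E = 1\<^sub>m m - B * L"
    note E = complement_projection[OF B L LB, folded E_def]
    \<comment> \<open>The component of \<open>u\<close> in the kernel of \<open>L\<close>: it stays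
      in \<open>W\<close> because it differs from \<open>u\<close> by a column combination of
      \<open>B\<close>, and it is nonzero because \<open>u\<close> is not such a
      combination.\<close>
    define w where "w = E *\<^sub>v u"
    have wc: "w \<in> carrier_vec m" using E uc by (simp add: w_def)
    have BLu: "B *\<^sub>v (L *\<^sub>v u) \<in> (\<lambda>x. B *\<^sub>v x) ` carrier_vec k" using L uc by auto
    have w_eq: "w = u - B *\<^sub>v (L *\<^sub>v u)"
      unfolding w_def E_def using B L uc by (subst minus_mult_distrib_mat_vec[of _ m m]) auto
    also have "\<dots> = u + (-1) \<cdot>\<^sub>v (B *\<^sub>v (L *\<^sub>v u))"
      using B uc by (intro eq_vecI) auto
    finally have wW: "w \<in> W" using Wadd[OF u Wsm[of _ "-1"]] BLu sub by auto
    have "w \<noteq> 0\<^sub>v m"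
    proof
      assume w0: "w = 0\<^sub>v m"
      have "u = B *\<^sub>v (L *\<^sub>v u)"
      proof (rule eq_vecI)
        show "dim_vec u = dim_vec (B *\<^sub>v (L *\<^sub>v u))" using uc B by simp
        fix i assume "i < dim_vec (B *\<^sub>v (L *\<^sub>v u))"
        moreover from this have "w $ i = u $ i - (B *\<^sub>v (L *\<^sub>v u)) $ i" unfolding w_eq by simp
        moreover from calculation have "w $ i = 0" using B unfolding w0 by simp
        ultimately show "u $ i = (B *\<^sub>v (L *\<^sub>v u)) $ i" by simp
      qed
      then show False using notin BLu by simp
    qed
    then obtain i where i: "i < m" "w $ i \<noteq> 0" using wc by (metis carrier_vecD eq_vecI index_zero_vec)
    \<comment> \<open>A functional reading a nonzero coordinate of \<open>w\<close>, scaled to take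
      the value 1 on \<open>w\<close>; functional and vectors are written as one-row and one-column
      matrices to fit into blocks.\<close>
    define e where "e = mat 1 m (\<lambda>(_, j). if j = i then 1 / w $ i else 0)"
    define Uc where "Uc = mat m 1 (\<lambda>(j, _). u $ j)"
    define Wc where "Wc = mat m 1 (\<lambda>(j, _). w $ j)"
    have e: "e \<in> carrier_mat 1 m" and Uc: "Uc \<in> carrier_mat m 1" and Wc: "Wc \<in> carrier_mat m 1"
      by (simp_all add: e_def Uc_def Wc_def)
    note dims = carrier_matD[OF B] carrier_matD[OF L] carrier_matD[OF E(1)] carrier_matD[OF e]
      carrier_matD[OF Uc] carrier_matD[OF Wc]
    have "col Uc 0 = u" using uc by (intro eq_vecI) (auto simp: Uc_def)
    then have WE: "Wc = E * Uc"
      using E uc by (intro eq_matI) (auto simp: Wc_def w_def dims mult_mat_vec_def)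
    have ew: "e * Wc = 1\<^sub>m 1"
    proof (rule eq_matI)
      fix a b assume "a < dim_row (1\<^sub>m 1 :: 'a mat)" "b < dim_col (1\<^sub>m 1 :: 'a mat)"
      moreover have "(\<Sum>j = 0..<m. (if j = i then 1 / w $ i else 0) * w $ j) = 1"
        using i by (subst sum.remove[of _ i]) auto
      ultimately show "(e * Wc) $$ (a, b) = 1\<^sub>m 1 $$ (a, b)"
        by (simp add: e_def Wc_def scalar_prod_def)
    qed (simp_all add: e_def Wc_def)
    define B' where "B' = four_block_mat B Wc (0\<^sub>m 0 k) (0\<^sub>m 0 1)"
    \<comment> \<open>The new row is \<open>e * E\<close> rather than \<open>e\<close>: composing
      with \<open>E\<close> makes it vanish on the columns of \<open>B\<close> and leaves its value
      on \<open>w\<close> unchanged.\<close>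
    define L' where "L' = four_block_mat L (0\<^sub>m k 0) (e * E) (0\<^sub>m 1 0)"
    have B': "B' \<in> carrier_mat m (k + 1)" using B Wc by (auto simp: B'_def)
    have L': "L' \<in> carrier_mat (k + 1) m" using L e E by (auto simp: L'_def)
    have "L * Wc = L * E * Uc" using L E(1) Uc by (simp add: WE assoc_mat dims)
    then have LW: "L * Wc = 0\<^sub>m k 1" unfolding E(2) using Uc by simp
    have eEB: "e * E * B = 0\<^sub>m 1 k" using e E by (simp add: assoc_mat dims)
    have "e * E * Wc = e * (E * E) * Uc" by (simp add: WE assoc_mat dims del: E)
    then have eEW: "e * E * Wc = 1\<^sub>m 1" using ew by (simp add: E WE assoc_mat dims)
    have "L' * B' = four_block_mat (1\<^sub>m k) (0\<^sub>m k 1) (0\<^sub>m 1 k) (1\<^sub>m 1)"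
      unfolding L'_def B'_def
      by (subst mult_four_block_mat[of _ k m _ 0 _ 1 _ _ k _ 1])
        (use L B Wc e E in \<open>simp_all add: LB LW eEB eEW\<close>)
    then have L'B': "L' * B' = 1\<^sub>m (k + 1)" by simp
    have "B' *\<^sub>v x \<in> W" if x: "x \<in> carrier_vec (k + 1)" for x
    proof -
      have y: "vec_first x k \<in> carrier_vec k" by simp
      have "B' *\<^sub>v x = B *\<^sub>v vec_first x k + x $ k \<cdot>\<^sub>v w"
      proof (rule eq_vecI)
        fix j assume "j < dim_vec (B *\<^sub>v vec_first x k + x $ k \<cdot>\<^sub>v w)"
        then have j: "j < m" using wc by simp
        show "(B' *\<^sub>v x) $ j = (B *\<^sub>v vec_first x k + x $ k \<cdot>\<^sub>v w) $ j"
          using j x wc by (auto simp: B'_def scalar_prod_def dims Wc_def vec_first_def)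
      qed (use B' wc in auto)
      moreover have "B *\<^sub>v vec_first x k \<in> W" using sub y by blast
      ultimately show ?thesis using Wadd Wsm wW by simp
    qed
    then have "Q (k + 1)" unfolding Q_def using B' L' L'B' by blast
    then show False using max by simp
  qed
  then show thesis using that B L LB sub by blast
qed

lemma mult_mat_unit_vec:
  fixes A :: "'a :: semiring_1 mat"
  assumes "A \<in> carrier_mat m k" and "j < k"
  shows "A *\<^sub>v unit_vec k j = col A j"
  using assms by (intro eq_vecI) auto

lemma subspace_range:
  fixes A :: "'a :: field mat"
  assumes A: "A \<in> carrier_mat n m"
  shows "VectorSpace.subspace class_ring ((\<lambda>x. A *\<^sub>v x) ` carrier_vec m) (module_vec TYPE('a) n)"
proof -
  have "0\<^sub>v n = A *\<^sub>v 0\<^sub>v m" using A by (intro eq_vecI) auto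
  moreover have "A *\<^sub>v v + A *\<^sub>v w = A *\<^sub>v (v + w)" if "v \<in> carrier_vec m" "w \<in> carrier_vec m" for v w
    using A that by (simp add: mult_add_distrib_mat_vec)
  moreover have "c \<cdot>\<^sub>v (A *\<^sub>v v) = A *\<^sub>v (c \<cdot>\<^sub>v v)" if "v \<in> carrier_vec m" for c v
    using A that by (simp add: mult_mat_vec)
  ultimately show ?thesis
    unfolding subspace_iff using A by (force simp: image_iff)
qed

text \<open>The complement is the kernel of \<open>L\<close>, given a basis as the range of the
  projection \<open>E\<close>.\<close>

lemma complement_exists:
  fixes B L :: "'a :: field mat"
  assumes B: "B \<in> carrier_mat m k" and L: "L \<in> carrier_mat k m" and LB: "L * B = 1\<^sub>m k"
  obtains k' B' L' where "B' \<in> carrier_mat m k'" "L' \<in> carrier_mat k' m" "L' * B' = 1\<^sub>m k'"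
    "L' * B = 0\<^sub>m k' k" "L * B' = 0\<^sub>m k k'" "B * L + B' * L' = 1\<^sub>m m" "m = k + k'"
proof -
  define E where "E = 1\<^sub>m m - B * L"
  note E = complement_projection[OF B L LB, folded E_def]
  let ?W = "(\<lambda>x. E *\<^sub>v x) ` carrier_vec m"
  have "VectorSpace.subspace class_ring ?W (module_vec TYPE('a) m)"
    by (rule subspace_range) (rule E(1))
  then obtain k' B' L0 where B': "B' \<in> carrier_mat m k'" and L0: "L0 \<in> carrier_mat k' m"
    and LB0: "L0 * B' = 1\<^sub>m k'" and rng: "?W = (\<lambda>x. B' *\<^sub>v x) ` carrier_vec k'"
    by (rule subspace_basis_matrix)
  note dims = carrier_matD[OF B] carrier_matD[OF L] carrier_matD[OF E(1)] carrier_matD[OF B'] carrier_matD[OF L0]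
  have EB': "E * B' = B'"
  proof (rule mat_col_eqI)
    fix j assume j: "j < dim_col B'"
    have "B' *\<^sub>v unit_vec k' j \<in> ?W" unfolding rng by auto
    then obtain x where x: "x \<in> carrier_vec m" and eq: "col B' j = E *\<^sub>v x"
      using B' j by (auto simp: mult_mat_unit_vec)
    have "col (E * B') j = E *\<^sub>v col B' j" using E(1) B' j by (intro col_mult2) auto
    also have "\<dots> = E * E *\<^sub>v x" unfolding eq using E(1) x by (subst assoc_mult_mat_vec) auto
    finally show "col (E * B') j = col B' j" using eq E by simp
  qed (use E B' in auto)
  have BLE: "B' * (L0 * E) = E"
  proof (rule mat_col_eqI)
    fix j assume j: "j < dim_col E"
    then have jm: "j < m" by (simp add: dims)
    have "E *\<^sub>v unit_vec m j \<in> (\<lambda>x. B' *\<^sub>v x) ` carrier_vec k'" using rng by (metis imageI unit_vec_carrier)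
    then obtain y where y: "y \<in> carrier_vec k'" and eq: "col E j = B' *\<^sub>v y"
      using E jm by (auto simp: mult_mat_unit_vec)
    have "col (B' * (L0 * E)) j = B' *\<^sub>v (L0 *\<^sub>v col E j)"
      using col_mult2[OF B' mult_carrier_mat[OF L0 E(1)] jm] col_mult2[OF L0 E(1) jm] by simp
    also have "L0 *\<^sub>v col E j = L0 * B' *\<^sub>v y" unfolding eq using L0 B' y by simp
    finally show "col (B' * (L0 * E)) j = col E j" using eq y LB0 by simp
  qed (use E B' in auto)
  \<comment> \<open>An arbitrary left inverse \<open>L0\<close> of \<open>B'\<close> need not kill
    \<open>B\<close>; preceding it by \<open>E\<close> repairs this.\<close>
  define L' where "L' = L0 * E"
  have L': "L' \<in> carrier_mat k' m" using L0 E by (simp add: L'_def)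
  have 1: "L' * B' = 1\<^sub>m k'" by (simp add: L'_def assoc_mat dims EB' LB0)
  have 2: "L' * B = 0\<^sub>m k' k" using L0 by (simp add: L'_def assoc_mat dims E)
  have "L * B' = L * E * B'" by (simp add: assoc_mat dims EB' del: E)
  then have 3: "L * B' = 0\<^sub>m k k'" using B' by (simp add: E)
  have 4: "B * L + B' * L' = 1\<^sub>m m"
    unfolding L'_def BLE unfolding E_def using B L by (intro eq_matI) auto
  \<comment> \<open>Stacking the two coordinate maps and juxtaposing the two bases gives mutually
    inverse matrices, so the dimension bound applies in both directions.\<close>
  let ?P = "four_block_mat L (0\<^sub>m k 0) L' (0\<^sub>m k' 0)"
  let ?Q = "four_block_mat B B' (0\<^sub>m 0 k) (0\<^sub>m 0 k')"
  have P: "?P \<in> carrier_mat (k + k') m" and Q: "?Q \<in> carrier_mat m (k + k')"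
    using B L B' L' by auto
  have PQ: "?P * ?Q = 1\<^sub>m (k + k')"
    by (subst mult_four_block_mat[of _ k m _ 0 _ k' _ _ k _ k'])
      (use L B L' B' in \<open>simp_all add: LB 1 2 3\<close>)
  have QP: "?Q * ?P = 1\<^sub>m m"
    by (subst mult_four_block_mat[of _ m k _ k' _ 0 _ _ m _ 0]) (use L B L' B' 4 in auto)
  have "m = k + k'" using left_inverse_dim_le[OF P Q PQ] left_inverse_dim_le[OF Q P QP] by simp
  then show thesis using that B' L' 1 2 3 4 by blast
qed

subsection \<open>Compressions and intertwiners\<close>

lemma carrier_GL:
  "carrier (GL n) = {A \<in> carrier_mat n n. \<exists>B \<in> carrier_mat n n. B * A = 1\<^sub>m n \<and> A * B = 1\<^sub>m n}"
  by (auto simp: GL_def units_of_def Units_def ring_mat_def)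

lemma mult_GL: "x \<otimes>\<^bsub>GL n\<^esub> y = x * y" and one_GL: "\<one>\<^bsub>GL n\<^esub> = 1\<^sub>m n"
  by (simp_all add: GL_def units_of_def ring_mat_def)

lemma group_GL: "group (GL n)"
  unfolding GL_def by (rule monoid.units_group) (rule ring.axioms(2), rule ring_mat)

text \<open>Invertibility of each value is automatic: \<rho> of the inverse element supplies the
  inverse matrix.\<close>

lemma is_repI:
  assumes "group G"
    and car: "\<And>g. g \<in> carrier G \<Longrightarrow> \<rho> g \<in> carrier_mat n n"
    and mult: "\<And>g h. g \<in> carrier G \<Longrightarrow> h \<in> carrier G \<Longrightarrow> \<rho> (g \<otimes>\<^bsub>G\<^esub> h) = \<rho> g * \<rho> h"
    and one: "\<rho> \<one>\<^bsub>G\<^esub> = 1\<^sub>m n"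
  shows "is_rep G n \<rho>"
proof -
  interpret group G by fact
  have "\<rho> g \<in> carrier (GL n)" if g: "g \<in> carrier G" for g
  proof -
    have "\<rho> (inv\<^bsub>G\<^esub> g) * \<rho> g = 1\<^sub>m n" "\<rho> g * \<rho> (inv\<^bsub>G\<^esub> g) = 1\<^sub>m n"
      using g by (simp_all add: one flip: mult)
    then show ?thesis using car g unfolding carrier_GL by blast
  qed
  then show ?thesis by (auto simp: is_rep_def hom_def mult_GL mult)
qed

lemma is_repD:
  assumes "is_rep G n \<rho>"
  shows "g \<in> carrier G \<Longrightarrow> \<rho> g \<in> carrier_mat n n"
    and "g \<in> carrier G \<Longrightarrow> h \<in> carrier G \<Longrightarrow> \<rho> (g \<otimes>\<^bsub>G\<^esub> h) = \<rho> g * \<rho> h"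
    and "group G \<Longrightarrow> \<rho> \<one>\<^bsub>G\<^esub> = 1\<^sub>m n"
proof -
  have hom: "\<rho> \<in> hom G (GL n)" using assms by (simp add: is_rep_def)
  then show "g \<in> carrier G \<Longrightarrow> \<rho> g \<in> carrier_mat n n"
    using hom_in_carrier[of \<rho> G "GL n" g] by (simp add: carrier_GL)
  show "g \<in> carrier G \<Longrightarrow> h \<in> carrier G \<Longrightarrow> \<rho> (g \<otimes>\<^bsub>G\<^esub> h) = \<rho> g * \<rho> h"
    using hom_mult[OF hom] by (simp add: mult_GL)
  show "group G \<Longrightarrow> \<rho> \<one>\<^bsub>G\<^esub> = 1\<^sub>m n"
    using hom_one[OF hom _ group_GL] by (simp add: one_GL)
qed

text \<open>Covers both subrepresentations (the columns of \<open>B\<close> span an invariant subspace) and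
  quotients (the kernel of \<open>L\<close> is invariant): either property lets \<open>B * L\<close> be dropped.\<close>

lemma is_rep_compression:
  assumes G: "group G" and rep: "is_rep G m \<rho>"
    and B: "B \<in> carrier_mat m k" and L: "L \<in> carrier_mat k m" and LB: "L * B = 1\<^sub>m k"
    and drop: "(\<forall>g \<in> carrier G. B * (L * \<rho> g * B) = \<rho> g * B) \<or>
      (\<forall>g \<in> carrier G. L * \<rho> g * B * L = L * \<rho> g)"
  shows "is_rep G k (\<lambda>g. L * \<rho> g * B)"
proof (rule is_repI[OF G])
  note R = is_repD[OF rep]
  note dims = carrier_matD[OF B] carrier_matD[OF L] carrier_matD[OF R(1)]
  show "L * \<rho> g * B \<in> carrier_mat k k" if "g \<in> carrier G" for g
    using R(1)[OF that] B L by auto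
  show "L * \<rho> \<one>\<^bsub>G\<^esub> * B = 1\<^sub>m k" using R(3)[OF G] L LB by simp
  fix g h assume g: "g \<in> carrier G" and h: "h \<in> carrier G"
  have "L * \<rho> g * B * (L * \<rho> h * B) = L * (\<rho> g * (\<rho> h * B))"
    \<comment> \<open>The inner \<open>B * L\<close> can be absorbed by the right factor in the
      subrepresentation case, by the left factor in the quotient case.\<close>
    using drop
  proof
    assume "\<forall>g \<in> carrier G. B * (L * \<rho> g * B) = \<rho> g * B"
    then have "L * \<rho> g * (B * (L * \<rho> h * B)) = L * \<rho> g * (\<rho> h * B)" using h by simp
    then show ?thesis using g h by (simp add: assoc_mat dims del: assoc_mult_mat)
  next
    assume "\<forall>g \<in> carrier G. L * \<rho> g * B * L = L * \<rho> g"
    then have "L * \<rho> g * B * L * (\<rho> h * B) = L * \<rho> g * (\<rho> h * B)" using g by simp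
    then show ?thesis using g h by (simp add: assoc_mat dims del: assoc_mult_mat)
  qed
  then show "L * \<rho> (g \<otimes>\<^bsub>G\<^esub> h) * B = L * \<rho> g * B * (L * \<rho> h * B)"
    using g h by (simp add: R(2) assoc_mat dims del: assoc_mult_mat)
qed

text \<open>\<open>H\<close> is a bare set, so that a representation of a group can be compared
  directly with one of a subgroup.\<close>

definition intertwiner ::
  "'g set \<Rightarrow> nat \<Rightarrow> ('g \<Rightarrow> complex mat) \<Rightarrow> nat \<Rightarrow> ('g \<Rightarrow> complex mat) \<Rightarrow> complex mat \<Rightarrow> bool" where
  "intertwiner H m \<rho> n \<sigma> \<Phi> \<longleftrightarrow> \<Phi> \<in> carrier_mat n m \<and> (\<forall>h \<in> H. \<Phi> * \<rho> h = \<sigma> h * \<Phi>)"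

text \<open>The range of \<Phi> is invariant and nonzero, hence everything by irreducibility;
  preimages of the unit vectors are the columns of \<open>S\<close>.\<close>

lemma intertwiner_right_inverse:
  assumes irr: "irreducible_rep G n \<pi>" and rep: "is_rep G m \<rho>"
    and \<Phi>: "intertwiner (carrier G) m \<rho> n \<pi> \<Phi>" and nz: "\<Phi> \<noteq> 0\<^sub>m n m"
  obtains S where "S \<in> carrier_mat m n" "\<Phi> * S = 1\<^sub>m n"
proof -
  have \<Phi>c: "\<Phi> \<in> carrier_mat n m" and \<Phi>e: "\<And>h. h \<in> carrier G \<Longrightarrow> \<Phi> * \<rho> h = \<pi> h * \<Phi>"
    using \<Phi> by (auto simp: intertwiner_def)
  have \<pi>: "is_rep G n \<pi>" using irr by (simp add: irreducible_rep_def)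
  let ?W = "(\<lambda>x. \<Phi> *\<^sub>v x) ` carrier_vec m"
  have "\<pi> h *\<^sub>v (\<Phi> *\<^sub>v v) \<in> ?W" if h: "h \<in> carrier G" and v: "v \<in> carrier_vec m" for h v
  proof -
    have "\<pi> h *\<^sub>v (\<Phi> *\<^sub>v v) = \<Phi> *\<^sub>v (\<rho> h *\<^sub>v v)"
      using assoc_mult_mat_vec[OF is_repD(1)[OF \<pi> h] \<Phi>c v]
        assoc_mult_mat_vec[OF \<Phi>c is_repD(1)[OF rep h] v] \<Phi>e[OF h] by simp
    then show ?thesis using mult_mat_vec_carrier[OF is_repD(1)[OF rep h] v] by blast
  qed
  then have "invariant_subspace G n \<pi> ?W"
    unfolding invariant_subspace_def using subspace_range[OF \<Phi>c] by blast
  then have "?W = {0\<^sub>v n} \<or> ?W = carrier_vec n" using irr by (auto simp: irreducible_rep_def)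
  moreover have "?W \<noteq> {0\<^sub>v n}"
  proof
    assume "?W = {0\<^sub>v n}"
    then have "\<Phi> *\<^sub>v unit_vec m j = 0\<^sub>v n" for j by (metis imageI singletonD unit_vec_carrier)
    then have "col \<Phi> j = 0\<^sub>v n" if "j < m" for j using mult_mat_unit_vec[OF \<Phi>c that] by simp
    then have "\<Phi> = 0\<^sub>m n m" using \<Phi>c by (intro mat_col_eqI) auto
    then show False using nz by simp
  qed
  ultimately have surj: "?W = carrier_vec n" by blast
  have "\<exists>x \<in> carrier_vec m. \<Phi> *\<^sub>v x = unit_vec n j" for j
  proof -
    have "unit_vec n j \<in> ?W" unfolding surj by simp
    then show ?thesis by (elim imageE) (auto intro: bexI sym)
  qed
  then obtain s where s: "\<And>j. s j \<in> carrier_vec m" "\<And>j. \<Phi> *\<^sub>v s j = unit_vec n j" by metis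
  define S where "S = mat m n (\<lambda>(i, j). s j $ i)"
  have "S \<in> carrier_mat m n" by (simp add: S_def)
  moreover have "\<Phi> * S = 1\<^sub>m n"
  proof (rule mat_col_eqI)
    fix j assume "j < dim_col (1\<^sub>m n :: complex mat)"
    then have j: "j < n" by simp
    moreover have "col S j = s j" using s(1)[of j] j by (intro eq_vecI) (auto simp: S_def)
    ultimately show "col (\<Phi> * S) j = col (1\<^sub>m n) j"
      using col_mult2[OF \<Phi>c \<open>S \<in> _\<close> j] s(2) by simp
  qed (use \<Phi>c in \<open>auto simp: S_def\<close>)
  ultimately show thesis by (rule that)
qed

lemma irreducible_cover:
  assumes G: "group G" and rep: "is_rep G m \<rho>" and triv: "\<And>x. x \<in> K \<Longrightarrow> \<rho> x = 1\<^sub>m m"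
    and KG: "K \<subseteq> carrier G" and HG: "H \<subseteq> carrier G"
    and \<pi>: "\<And>h. h \<in> H \<Longrightarrow> \<pi> h \<in> carrier_mat n n"
    and \<Phi>: "intertwiner H m \<rho> n \<pi> \<Phi>" and nz: "\<Phi> \<noteq> 0\<^sub>m n m"
  obtains k R \<Psi> where "irreducible_rep G k R" "\<And>x. x \<in> K \<Longrightarrow> R x = 1\<^sub>m k"
    "intertwiner H k R n \<pi> \<Psi>" "\<Psi> \<noteq> 0\<^sub>m n k"
proof -
  define Q where "Q k \<longleftrightarrow> (\<exists>R \<Psi>. is_rep G k R \<and> (\<forall>x \<in> K. R x = 1\<^sub>m k) \<and>
    intertwiner H k R n \<pi> \<Psi> \<and> \<Psi> \<noteq> 0\<^sub>m n k)" for k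
  have "Q m" unfolding Q_def using rep triv \<Phi> nz by blast
  define k where "k = (LEAST k. Q k)"
  have min: "\<not> Q j" if "j < k" for j using that not_less_Least unfolding k_def by blast
  from LeastI[of Q, OF \<open>Q m\<close>] obtain R \<Psi> where R: "is_rep G k R" and RK: "\<And>x. x \<in> K \<Longrightarrow> R x = 1\<^sub>m k"
    and \<Psi>: "intertwiner H k R n \<pi> \<Psi>" and \<Psi>nz: "\<Psi> \<noteq> 0\<^sub>m n k"
    unfolding Q_def k_def by blast
  have \<Psi>c: "\<Psi> \<in> carrier_mat n k" and \<Psi>e: "\<And>h. h \<in> H \<Longrightarrow> \<Psi> * R h = \<pi> h * \<Psi>"
    using \<Psi> by (auto simp: intertwiner_def)
  have "W = {0\<^sub>v k} \<or> W = carrier_vec k" if W: "invariant_subspace G k R W" for W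
  proof -
    obtain a B L where B: "B \<in> carrier_mat k a" and L: "L \<in> carrier_mat a k"
      and LB: "L * B = 1\<^sub>m a" and WB: "W = (\<lambda>x. B *\<^sub>v x) ` carrier_vec a"
      using W subspace_basis_matrix unfolding invariant_subspace_def by metis
    obtain b B' L' where B': "B' \<in> carrier_mat k b" and L': "L' \<in> carrier_mat b k"
      and LB': "L' * B' = 1\<^sub>m b" and L'B: "L' * B = 0\<^sub>m b a"
      and sum: "B * L + B' * L' = 1\<^sub>m k" and k: "k = a + b"
      by (rule complement_exists[OF B L LB])
    note dims = carrier_matD[OF B] carrier_matD[OF L] carrier_matD[OF B'] carrier_matD[OF L']
      carrier_matD[OF is_repD(1)[OF R]] carrier_matD[OF \<Psi>c] carrier_matD[OF \<pi>]
    \<comment> \<open>\<open>R g\<close> maps the columns of \<open>B\<close> into \<open>W\<close>,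
      on which the projection \<open>B * L\<close> is the identity.\<close>
    have inv: "B * (L * R g * B) = R g * B" if g: "g \<in> carrier G" for g
    proof (rule mat_col_eqI)
      note Rg = is_repD(1)[OF R g]
      fix j assume "j < dim_col (R g * B)"
      then have j: "j < a" by (simp add: dims)
      have "B *\<^sub>v unit_vec a j \<in> W" unfolding WB by simp
      then have "col B j \<in> W" using mult_mat_unit_vec[OF B j] by simp
      then have "R g *\<^sub>v col B j \<in> W" using W g by (simp add: invariant_subspace_def)
      then obtain x where x: "x \<in> carrier_vec a" and eq: "R g *\<^sub>v col B j = B *\<^sub>v x"
        unfolding WB by blast
      have c: "col (R g * B) j = B *\<^sub>v x" using eq col_mult2[OF Rg B j] by simp
      have "B * (L * R g * B) = B * L * (R g * B)"
        using g by (simp add: assoc_mat dims del: assoc_mult_mat)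
      then have "col (B * (L * R g * B)) j = B * L *\<^sub>v (B *\<^sub>v x)"
        using col_mult2[OF mult_carrier_mat[OF B L] mult_carrier_mat[OF Rg B] j] c by simp
      also have "\<dots> = B *\<^sub>v (L * B *\<^sub>v x)"
        using B L x by (simp add: assoc_mult_mat_vec[of _ k a _ k] assoc_mult_mat_vec[of _ a k _ a])
      finally show "col (B * (L * R g * B)) j = col (R g * B) j" using c x by (simp add: LB)
    qed (use g in \<open>simp_all add: dims\<close>)
    \<comment> \<open>The kernel of \<open>L'\<close> is \<open>W\<close>, so \<open>L'\<close> is
      the quotient map. Inserting \<open>B * L + B' * L'\<close>, the first summand contributes
      nothing by invariance of \<open>W\<close>.\<close>
    have inv': "L' * R g * B' * L' = L' * R g" if g: "g \<in> carrier G" for g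
    proof -
      note Rg = is_repD(1)[OF R g]
      have "L' * R g * B = L' * (B * (L * R g * B))"
        unfolding inv[OF g] using g by (simp add: assoc_mat dims del: assoc_mult_mat)
      also have "\<dots> = L' * B * (L * R g * B)"
        using g by (simp add: assoc_mat dims del: assoc_mult_mat)
      also have "\<dots> = 0\<^sub>m b a" unfolding L'B using L Rg B by simp
      finally have z: "L' * R g * B = 0\<^sub>m b a" .
      have "L' * R g = L' * R g * (B * L + B' * L')" unfolding sum using L' Rg by simp
      also have "\<dots> = L' * R g * (B * L) + L' * R g * (B' * L')"
        by (rule mult_add_distrib_mat) (use L' Rg B L B' in auto)
      also have "L' * R g * (B * L) = L' * R g * B * L"
        using g by (simp add: assoc_mat dims del: assoc_mult_mat)
      also have "\<dots> = 0\<^sub>m b k" unfolding z using L by simp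
      also have "L' * R g * (B' * L') = L' * R g * B' * L'"
        using g by (simp add: assoc_mat dims del: assoc_mult_mat)
      finally have "L' * R g = 0\<^sub>m b k + L' * R g * B' * L'" .
      also have "\<dots> = L' * R g * B' * L'" by (rule left_add_zero_mat) (use L' Rg B' in auto)
      finally show ?thesis by (rule sym)
    qed
    have repA: "is_rep G a (\<lambda>g. L * R g * B)"
      using inv by (intro is_rep_compression[OF G R B L LB]) blast
    have repD: "is_rep G b (\<lambda>g. L' * R g * B')"
      using inv' by (intro is_rep_compression[OF G R B' L' LB']) blast
    have "a = 0 \<or> b = 0"
    proof (rule ccontr)
      assume "\<not> (a = 0 \<or> b = 0)"
      then have less: "a < k" "b < k" using k by auto
      show False
      proof (cases "\<Psi> * B = 0\<^sub>m n a")
        case False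
        have "intertwiner H a (\<lambda>g. L * R g * B) n \<pi> (\<Psi> * B)"
          unfolding intertwiner_def
        proof (intro conjI ballI)
          fix h assume h: "h \<in> H"
          then have hG: "h \<in> carrier G" using HG by blast
          have "\<Psi> * B * (L * R h * B) = \<Psi> * (B * (L * R h * B))"
            using hG by (simp add: assoc_mat dims del: assoc_mult_mat)
          also have "\<dots> = \<Psi> * R h * B"
            unfolding inv[OF hG] using hG by (simp add: assoc_mat dims del: assoc_mult_mat)
          also have "\<dots> = \<pi> h * (\<Psi> * B)"
            unfolding \<Psi>e[OF h] using h by (simp add: assoc_mat dims del: assoc_mult_mat)
          finally show "\<Psi> * B * (L * R h * B) = \<pi> h * (\<Psi> * B)" .
        qed (use \<Psi>c B in simp)
        moreover have "L * R x * B = 1\<^sub>m a" if "x \<in> K" for x using RK[OF that] L LB by simp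
        ultimately have "Q a" unfolding Q_def using repA False by blast
        then show False using min less by blast
      next
        case True
        have "\<Psi> = \<Psi> * (B * L + B' * L')" unfolding sum using \<Psi>c by simp
        also have "\<dots> = \<Psi> * (B * L) + \<Psi> * (B' * L')"
          by (rule mult_add_distrib_mat) (use \<Psi>c B L B' L' in auto)
        also have "\<Psi> * (B * L) = \<Psi> * B * L" by (simp add: assoc_mat dims del: assoc_mult_mat)
        also have "\<dots> = 0\<^sub>m n k" unfolding True using L by simp
        also have "\<Psi> * (B' * L') = \<Psi> * B' * L'" by (simp add: assoc_mat dims del: assoc_mult_mat)
        \<comment> \<open>A map vanishing on \<open>W\<close> factors through the quotient map
          \<open>L'\<close>, with \<open>\<Psi> * B'\<close> as the induced map.\<close>
        finally have fact: "\<Psi> * B' * L' = \<Psi>" using \<Psi>c B' L' by simp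
        have "intertwiner H b (\<lambda>g. L' * R g * B') n \<pi> (\<Psi> * B')"
          unfolding intertwiner_def
        proof (intro conjI ballI)
          fix h assume h: "h \<in> H"
          then have hG: "h \<in> carrier G" using HG by blast
          have "\<Psi> * B' * (L' * R h * B') = \<Psi> * B' * L' * R h * B'"
            using hG by (simp add: assoc_mat dims del: assoc_mult_mat)
          also have "\<dots> = \<pi> h * (\<Psi> * B')"
            unfolding fact \<Psi>e[OF h] using h by (simp add: assoc_mat dims del: assoc_mult_mat)
          finally show "\<Psi> * B' * (L' * R h * B') = \<pi> h * (\<Psi> * B')" .
        qed (use \<Psi>c B' in simp)
        moreover have "L' * R x * B' = 1\<^sub>m b" if "x \<in> K" for x using RK[OF that] L' LB' by simp
        moreover have "\<Psi> * B' \<noteq> 0\<^sub>m n b" using fact \<Psi>nz L' by auto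
        ultimately have "Q b" unfolding Q_def using repD by blast
        then show False using min less by blast
      qed
    qed
    then show ?thesis
    proof
      assume "a = 0"
      then have "B *\<^sub>v x = 0\<^sub>v k" if "x \<in> carrier_vec a" for x
        using B that by (intro eq_vecI) (auto simp: scalar_prod_def)
      then have "W = (\<lambda>_. 0\<^sub>v k) ` (carrier_vec a :: complex vec set)"
        unfolding WB by (intro image_cong) auto
      also have "\<dots> = {0\<^sub>v k}" by (rule image_constant) (rule zero_carrier_vec)
      finally show ?thesis by simp
    next
      assume "b = 0"
      then have "B' * L' = 0\<^sub>m k k" using B' L' by (intro eq_matI) (auto simp: scalar_prod_def)
      then have BL: "B * L = 1\<^sub>m k" using sum B L by simp
      have "x \<in> W" if x: "x \<in> carrier_vec k" for x
      proof -
        have "x = B *\<^sub>v (L *\<^sub>v x)" using BL assoc_mult_mat_vec[OF B L x] x by simp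
        then show ?thesis unfolding WB using L x by (metis imageI mult_mat_vec_carrier)
      qed
      then show ?thesis unfolding WB using B by auto
    qed
  qed
  \<comment> \<open>A matrix without columns equals the zero matrix, which \<Psi> is not.\<close>
  moreover have "k \<noteq> 0" using \<Psi>c \<Psi>nz by auto
  ultimately have "irreducible_rep G k R" unfolding irreducible_rep_def using R by blast
  then show thesis using that RK \<Psi> \<Psi>nz by blast
qed

subsection \<open>Averaging over a finite quotient\<close>

lemma coset_indexing:
  fixes G (structure)
  assumes K: "K \<lhd> G" and fin: "finite (rcosets K)"
  obtains d and idx :: "'g \<Rightarrow> nat" and r :: "nat \<Rightarrow> 'g"
  where "\<And>x. x \<in> carrier G \<Longrightarrow> idx x < d" "\<And>i. i < d \<Longrightarrow> r i \<in> carrier G"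
    "\<And>i. i < d \<Longrightarrow> idx (r i) = i"
    "\<And>x y. x \<in> carrier G \<Longrightarrow> y \<in> carrier G \<Longrightarrow> idx x = idx y \<longleftrightarrow> x \<otimes> inv y \<in> K"
proof -
  interpret normal K G by fact
  define X where "X = rcosets K"
  obtain e where e: "bij_betw e X {0..<card X}"
    using ex_bij_betw_finite_nat[OF fin] unfolding X_def by blast
  have inX: "K #> x \<in> X" if "x \<in> carrier G" for x using that subset unfolding X_def by (rule rcosetsI[rotated])
  have eq: "K #> x = K #> y \<longleftrightarrow> x \<otimes> inv y \<in> K" if "x \<in> carrier G" "y \<in> carrier G" for x y
  proof -
    have "K #> x = K #> y \<longleftrightarrow> x \<in> K #> y"
      using that subgroup_axioms by (metis repr_independence rcos_self)
    also have "\<dots> \<longleftrightarrow> x \<otimes> inv y \<in> K" using that by (simp add: rcos_module[OF is_group])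
    finally show ?thesis .
  qed
  define idx where "idx x = e (K #> x)" for x
  have "\<exists>x \<in> carrier G. idx x = i" if "i < card X" for i
  proof -
    have "i \<in> e ` X" using e that by (simp add: bij_betw_def)
    then show ?thesis unfolding X_def RCOSETS_def idx_def by blast
  qed
  then obtain r where r: "\<And>i. i < card X \<Longrightarrow> r i \<in> carrier G" "\<And>i. i < card X \<Longrightarrow> idx (r i) = i" by metis
  have "\<And>x. x \<in> carrier G \<Longrightarrow> idx x < card X"
    using bij_betwE[OF e] inX by (auto simp: idx_def)
  moreover have "idx x = idx y \<longleftrightarrow> x \<otimes> inv y \<in> K" if "x \<in> carrier G" "y \<in> carrier G" for x y
    using inj_on_eq_iff[OF bij_betw_imp_inj_on[OF e] inX[OF that(1)] inX[OF that(2)]] eq[OF that]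
    by (simp add: idx_def)
  ultimately show thesis using that r by blast
qed

text \<open>Normality lets left translation act on right cosets: the quotient of the translates is a
  conjugate of the original quotient.\<close>

lemma (in normal) mult_left_mod:
  assumes "x \<in> carrier G" "y \<in> carrier G" "g \<in> carrier G" "x \<otimes> inv y \<in> H"
  shows "(g \<otimes> x) \<otimes> inv (g \<otimes> y) \<in> H"
proof -
  have "(g \<otimes> x) \<otimes> inv (g \<otimes> y) = g \<otimes> (x \<otimes> inv y) \<otimes> inv g"
    using assms by (simp add: m_assoc inv_mult_group)
  then show ?thesis using inv_op_closed2[OF assms(3,4)] by simp
qed

lemma (in subgroup) mem_iff_of_mod:
  assumes "group G" "x \<in> carrier G" "y \<in> carrier G" "x \<otimes> inv y \<in> H"
  shows "x \<in> H \<longleftrightarrow> y \<in> H"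
proof
  interpret group G by fact
  show "x \<in> H" if "y \<in> H"
    using subgroup.m_closed[OF subgroup_axioms assms(4) that] assms(2,3) by (simp add: m_assoc)
  show "y \<in> H" if "x \<in> H"
    using subgroup.m_closed[OF subgroup_axioms m_inv_closed[OF assms(4)] that] assms(2,3) by (simp add: m_assoc inv_mult_group)
qed

lemma rep_eq_of_mod:
  fixes G (structure)
  assumes "group G" "is_rep G n \<pi>" "x \<in> carrier G" "y \<in> carrier G"
    and "\<pi> (x \<otimes> inv y) = 1\<^sub>m n"
  shows "\<pi> x = \<pi> y"
proof -
  interpret group G by fact
  have "\<pi> x = \<pi> (x \<otimes> inv y \<otimes> y)" using assms(3,4) by (simp add: m_assoc)
  also have "\<dots> = \<pi> (x \<otimes> inv y) * \<pi> y" using assms by (intro is_repD(2)) auto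
  finally show ?thesis using assms(5) is_repD(1)[OF assms(2,4)] by simp
qed

section \<open>Averages of matrices and the equivariant section\<close>

text \<open>The size of a matrix belongs to its value, not its type, so a sum needs its dimensions
  as arguments.\<close>

definition scaled_sum_mat :: "nat \<Rightarrow> nat \<Rightarrow> 'a \<Rightarrow> ('i \<Rightarrow> 'a mat) \<Rightarrow> 'i set \<Rightarrow> 'a :: comm_semiring_0 mat" where
  "scaled_sum_mat nr nc c F I = mat nr nc (\<lambda>(i, j). c * (\<Sum>a\<in>I. F a $$ (i, j)))"

lemma scaled_sum_mat_carrier [simp]: "scaled_sum_mat nr nc c F I \<in> carrier_mat nr nc"
  by (simp add: scaled_sum_mat_def)

lemma mult_scaled_sum_mat:
  assumes A: "A \<in> carrier_mat l m" and F: "\<And>a. a \<in> I \<Longrightarrow> F a \<in> carrier_mat m n"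
  shows "A * scaled_sum_mat m n c F I = scaled_sum_mat l n c (\<lambda>a. A * F a) I"
proof (rule eq_matI)
  fix i j assume "i < dim_row (scaled_sum_mat l n c (\<lambda>a. A * F a) I)" "j < dim_col (scaled_sum_mat l n c (\<lambda>a. A * F a) I)"
  then have ij: "i < l" "j < n" by (auto simp: scaled_sum_mat_def)
  have "(A * scaled_sum_mat m n c F I) $$ (i, j) = (\<Sum>k = 0..<m. A $$ (i, k) * (c * (\<Sum>a\<in>I. F a $$ (k, j))))"
    using A ij by (auto simp: scaled_sum_mat_def scalar_prod_def intro!: sum.cong)
  also have "\<dots> = c * (\<Sum>k = 0..<m. \<Sum>a\<in>I. A $$ (i, k) * F a $$ (k, j))"
    by (simp add: sum_distrib_left mult.left_commute)
  also have "\<dots> = c * (\<Sum>a\<in>I. \<Sum>k = 0..<m. A $$ (i, k) * F a $$ (k, j))"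
    by (subst sum.swap) (rule refl)
  also have "\<dots> = c * (\<Sum>a\<in>I. (A * F a) $$ (i, j))"
    using A F ij by (intro arg_cong[where f = "(*) c"] sum.cong refl) (auto simp: scalar_prod_def dest!: F)
  finally show "(A * scaled_sum_mat m n c F I) $$ (i, j) = scaled_sum_mat l n c (\<lambda>a. A * F a) I $$ (i, j)"
    using ij by (simp add: scaled_sum_mat_def)
qed (use A in \<open>auto simp: scaled_sum_mat_def\<close>)

lemma scaled_sum_mat_mult:
  assumes A: "A \<in> carrier_mat n l" and F: "\<And>a. a \<in> I \<Longrightarrow> F a \<in> carrier_mat m n"
  shows "scaled_sum_mat m n c F I * A = scaled_sum_mat m l c (\<lambda>a. F a * A) I"
proof (rule eq_matI)
  fix i j assume "i < dim_row (scaled_sum_mat m l c (\<lambda>a. F a * A) I)" "j < dim_col (scaled_sum_mat m l c (\<lambda>a. F a * A) I)"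
  then have ij: "i < m" "j < l" by (auto simp: scaled_sum_mat_def)
  have "(scaled_sum_mat m n c F I * A) $$ (i, j) = (\<Sum>k = 0..<n. c * (\<Sum>a\<in>I. F a $$ (i, k)) * A $$ (k, j))"
    using A ij by (auto simp: scaled_sum_mat_def scalar_prod_def intro!: sum.cong)
  also have "\<dots> = c * (\<Sum>k = 0..<n. \<Sum>a\<in>I. F a $$ (i, k) * A $$ (k, j))"
    by (simp add: sum_distrib_left sum_distrib_right mult.assoc)
  also have "\<dots> = c * (\<Sum>a\<in>I. \<Sum>k = 0..<n. F a $$ (i, k) * A $$ (k, j))"
    by (subst sum.swap) (rule refl)
  also have "\<dots> = c * (\<Sum>a\<in>I. (F a * A) $$ (i, j))"
    using A F ij by (intro arg_cong[where f = "(*) c"] sum.cong refl) (auto simp: scalar_prod_def dest!: F)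
  finally show "(scaled_sum_mat m n c F I * A) $$ (i, j) = scaled_sum_mat m l c (\<lambda>a. F a * A) I $$ (i, j)"
    using ij by (simp add: scaled_sum_mat_def)
qed (use A in \<open>auto simp: scaled_sum_mat_def\<close>)

text \<open>Maschke's averaging: \<open>S\<close> is the mean of the conjugates
  \<open>\<rho> x * S0 * \<pi> (inv x)\<close> over the cosets of \<open>K\<close>.\<close>

lemma maschke_section:
  fixes G (structure)
  assumes K: "K \<lhd> G" and fin: "finite (rcosets K)"
    and \<rho>: "is_rep G m \<rho>" and \<pi>: "is_rep G n \<pi>"
    and \<rho>K: "\<And>x. x \<in> K \<Longrightarrow> \<rho> x = 1\<^sub>m m" and \<pi>K: "\<And>x. x \<in> K \<Longrightarrow> \<pi> x = 1\<^sub>m n"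
    and \<Phi>: "intertwiner (carrier G) m \<rho> n \<pi> \<Phi>" and S0: "S0 \<in> carrier_mat m n" "\<Phi> * S0 = 1\<^sub>m n"
  obtains S where "intertwiner (carrier G) n \<pi> m \<rho> S" "\<Phi> * S = 1\<^sub>m n"
proof -
  interpret normal K G by fact
  have \<Phi>c: "\<Phi> \<in> carrier_mat n m" and \<Phi>e: "\<And>h. h \<in> carrier G \<Longrightarrow> \<Phi> * \<rho> h = \<pi> h * \<Phi>"
    using \<Phi> by (auto simp: intertwiner_def)
  obtain d and idx :: "'a \<Rightarrow> nat" and r where idx: "\<And>x. x \<in> carrier G \<Longrightarrow> idx x < d"
    and r: "\<And>i. i < d \<Longrightarrow> r i \<in> carrier G" and idx_r: "\<And>i. i < d \<Longrightarrow> idx (r i) = i"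
    and idx_eq: "\<And>x y. x \<in> carrier G \<Longrightarrow> y \<in> carrier G \<Longrightarrow> idx x = idx y \<longleftrightarrow> x \<otimes> inv y \<in> K"
    by (rule coset_indexing[OF K fin]) blast
  note \<rho>D = is_repD[OF \<rho>] and \<pi>D = is_repD[OF \<pi>]
  note dims = carrier_matD[OF \<rho>D(1)] carrier_matD[OF \<pi>D(1)] carrier_matD[OF \<Phi>c] carrier_matD[OF S0(1)]
  have d: "d > 0" using idx[OF one_closed] by simp
  define f where "f x = \<rho> x * S0 * \<pi> (inv x)" for x
  have f: "f x \<in> carrier_mat m n" if "x \<in> carrier G" for x
    unfolding f_def using \<rho>D(1)[OF that] \<pi>D(1)[OF inv_closed[OF that]] S0(1) by simp
  have f_cong: "f x = f y" if x: "x \<in> carrier G" and y: "y \<in> carrier G" and xy: "idx x = idx y" for x y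
  proof -
    have k: "x \<otimes> inv y \<in> K" using idx_eq[OF x y] xy by simp
    then have "\<rho> x = \<rho> y" using x y \<rho> \<rho>K is_group by (intro rep_eq_of_mod[of G]) auto
    \<comment> \<open>Since \<pi> is evaluated at inverses, congruence modulo \<open>K\<close> must
      be carried over to them, which uses a conjugation by \<open>x\<close>.\<close>
    moreover have "inv x \<otimes> inv (inv y) \<in> K"
      using mult_left_mod[of x y "inv x"] m_inv_closed[OF inv_op_closed1[of x, OF x k]] x y k
      by (simp add: m_assoc[symmetric] inv_mult_group)
    then have "\<pi> (inv x) = \<pi> (inv y)" using x y \<pi> \<pi>K is_group by (intro rep_eq_of_mod[of G]) auto
    ultimately show ?thesis by (simp add: f_def)
  qed
  define S where "S = scaled_sum_mat m n (1 / of_nat d) (\<lambda>a. f (r a)) {..<d}"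
  have S: "S \<in> carrier_mat m n" by (simp add: S_def)
  \<comment> \<open>Every conjugate is itself a right inverse of \<Phi>, hence so is their
    mean.\<close>
  have "\<Phi> * f x = 1\<^sub>m n" if x: "x \<in> carrier G" for x
  proof -
    have "\<Phi> * f x = \<Phi> * \<rho> x * S0 * \<pi> (inv x)"
      using x by (simp add: f_def assoc_mat dims del: assoc_mult_mat)
    also have "\<dots> = \<pi> x * (\<Phi> * S0 * \<pi> (inv x))"
      unfolding \<Phi>e[OF x] using x by (simp add: assoc_mat dims del: assoc_mult_mat)
    also have "\<dots> = \<pi> x * \<pi> (inv x)" unfolding S0(2) using \<pi>D(1)[OF inv_closed[OF x]] by simp
    also have "\<dots> = 1\<^sub>m n" using \<pi>D(2)[OF x inv_closed[OF x]] \<pi>D(3)[OF is_group] x by simp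
    finally show ?thesis .
  qed
  then have "\<Phi> * S = scaled_sum_mat n n (1 / of_nat d) (\<lambda>_. 1\<^sub>m n) {..<d}"
    unfolding S_def using f r
    by (subst mult_scaled_sum_mat[OF \<Phi>c]) (auto simp: scaled_sum_mat_def intro!: eq_matI)
  also have "\<dots> = 1\<^sub>m n" using d by (intro eq_matI) (auto simp: scaled_sum_mat_def)
  finally have "\<Phi> * S = 1\<^sub>m n" .
  moreover have "S * \<pi> g = \<rho> g * S" if g: "g \<in> carrier G" for g
  proof -
    have step: "\<rho> g * f x = f (g \<otimes> x) * \<pi> g" if x: "x \<in> carrier G" for x
    proof -
      have "f (g \<otimes> x) * \<pi> g = \<rho> g * (\<rho> x * (S0 * (\<pi> (inv x) * (\<pi> (inv g) * \<pi> g))))"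
        using g x by (simp add: f_def inv_mult_group \<rho>D(2) \<pi>D(2) assoc_mat dims del: assoc_mult_mat)
      also have "\<pi> (inv g) * \<pi> g = 1\<^sub>m n"
        using \<pi>D(2)[OF inv_closed[OF g] g] \<pi>D(3)[OF is_group] g by simp
      finally show ?thesis
        using g x \<pi>D(1)[OF inv_closed[OF x]] by (simp add: f_def assoc_mat dims del: assoc_mult_mat)
    qed
    \<comment> \<open>Left multiplication by \<open>g\<close> permutes the finitely many cosets;
      reindexing the sum along this permutation gives equivariance.\<close>
    define \<sigma> where "\<sigma> a = idx (g \<otimes> r a)" for a
    have \<sigma>: "bij_betw \<sigma> {..<d} {..<d}"
    proof -
      have "a = b" if a: "a < d" and b: "b < d" and eq: "\<sigma> a = \<sigma> b" for a b
      proof -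
        have "(g \<otimes> r a) \<otimes> inv (g \<otimes> r b) \<in> K"
          using eq idx_eq r[OF a] r[OF b] g by (simp add: \<sigma>_def)
        from mult_left_mod[OF _ _ inv_closed[OF g] this]
        have "r a \<otimes> inv (r b) \<in> K" using r[OF a] r[OF b] g by (simp add: m_assoc[symmetric])
        then show ?thesis using idx_eq r[OF a] r[OF b] idx_r[OF a] idx_r[OF b] by metis
      qed
      then have inj: "inj_on \<sigma> {..<d}" by (auto intro: inj_onI)
      moreover have "\<sigma> ` {..<d} \<subseteq> {..<d}" using idx r g by (auto simp: \<sigma>_def)
      ultimately show ?thesis by (simp add: bij_betw_def endo_inj_surj)
    qed
    have fr: "f (r (\<sigma> a)) = f (g \<otimes> r a)" if "a < d" for a
      using that g r idx idx_r by (intro f_cong) (auto simp: \<sigma>_def)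
    have "S * \<pi> g = scaled_sum_mat m n (1 / of_nat d) (\<lambda>a. f (r a) * \<pi> g) {..<d}"
      unfolding S_def using f r \<pi>D(1)[OF g] by (intro scaled_sum_mat_mult) auto
    also have "\<dots> = scaled_sum_mat m n (1 / of_nat d) (\<lambda>a. f (r (\<sigma> a)) * \<pi> g) {..<d}"
      unfolding scaled_sum_mat_def
      using sum.reindex_bij_betw[OF \<sigma>, of "\<lambda>a. (f (r a) * \<pi> g) $$ _"] by simp
    also have "\<dots> = scaled_sum_mat m n (1 / of_nat d) (\<lambda>a. \<rho> g * f (r a)) {..<d}"
      unfolding scaled_sum_mat_def using step r fr by simp
    also have "\<dots> = \<rho> g * S"
      unfolding S_def using f r \<rho>D(1)[OF g] by (intro mult_scaled_sum_mat[symmetric]) auto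
    finally show ?thesis .
  qed
  ultimately show thesis using S by (intro that) (auto simp: intertwiner_def)
qed

text \<open>The space is the sum of the range of \<open>S\<close> and the kernel of \<Phi>. Stacking
  \<Phi> over coordinates \<open>L\<close> for the kernel gives the change of basis
  \<open>P\<close>.\<close>

lemma split_intertwiner_imp_direct_summand:
  assumes G: "group G" and \<rho>: "is_rep G m \<rho>" and \<pi>: "is_rep G n \<pi>"
    and \<Phi>: "intertwiner (carrier G) m \<rho> n \<pi> \<Phi>" and S: "intertwiner (carrier G) n \<pi> m \<rho> S"
    and \<Phi>S: "\<Phi> * S = 1\<^sub>m n"
  shows "direct_summand G n \<pi> m \<rho>"
proof -
  have \<Phi>c: "\<Phi> \<in> carrier_mat n m" and \<Phi>e: "\<And>h. h \<in> carrier G \<Longrightarrow> \<Phi> * \<rho> h = \<pi> h * \<Phi>"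
    and Sc: "S \<in> carrier_mat m n" and Se: "\<And>h. h \<in> carrier G \<Longrightarrow> S * \<pi> h = \<rho> h * S"
    using \<Phi> S by (auto simp: intertwiner_def)
  obtain k B L where B: "B \<in> carrier_mat m k" and L: "L \<in> carrier_mat k m" and LB: "L * B = 1\<^sub>m k"
    and LS: "L * S = 0\<^sub>m k n" and \<Phi>B: "\<Phi> * B = 0\<^sub>m n k" and sum: "S * \<Phi> + B * L = 1\<^sub>m m" and m: "m = n + k"
    by (rule complement_exists[OF Sc \<Phi>c \<Phi>S])
  note dims = carrier_matD[OF is_repD(1)[OF \<rho>]] carrier_matD[OF is_repD(1)[OF \<pi>]] carrier_matD[OF \<Phi>c]
    carrier_matD[OF Sc] carrier_matD[OF B] carrier_matD[OF L]
  define \<sigma> where "\<sigma> g = L * \<rho> g * B" for g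
  \<comment> \<open>The range of \<open>S\<close> is invariant and killed by \<open>L\<close>, so
    \<open>L\<close> behaves as the quotient map by it.\<close>
  have \<sigma>L: "\<sigma> g * L = L * \<rho> g" if g: "g \<in> carrier G" for g
  proof -
    note \<rho>g = is_repD(1)[OF \<rho> g] and \<pi>g = is_repD(1)[OF \<pi> g]
    have "L * \<rho> g * (S * \<Phi>) = L * (\<rho> g * S) * \<Phi>"
      using g by (simp add: assoc_mat dims del: assoc_mult_mat)
    also have "\<dots> = L * S * (\<pi> g * \<Phi>)"
      unfolding Se[OF g, symmetric] using g by (simp add: assoc_mat dims del: assoc_mult_mat)
    also have "\<dots> = 0\<^sub>m k m" unfolding LS using \<pi>g \<Phi>c by simp
    finally have z: "L * \<rho> g * (S * \<Phi>) = 0\<^sub>m k m" .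
    have "L * \<rho> g = L * \<rho> g * (S * \<Phi> + B * L)" unfolding sum using L \<rho>g by simp
    also have "\<dots> = L * \<rho> g * (S * \<Phi>) + L * \<rho> g * (B * L)"
      by (rule mult_add_distrib_mat) (use L \<rho>g B Sc \<Phi>c in auto)
    also have "\<dots> = L * \<rho> g * (B * L)" unfolding z by (rule left_add_zero_mat) (use L \<rho>g B in auto)
    also have "\<dots> = \<sigma> g * L" using g by (simp add: \<sigma>_def assoc_mat dims del: assoc_mult_mat)
    finally show ?thesis by simp
  qed
  have rep\<sigma>: "is_rep G k \<sigma>"
    unfolding \<sigma>_def using \<sigma>L by (intro is_rep_compression[OF G \<rho> B L LB]) (simp add: \<sigma>_def)
  define P where "P = four_block_mat \<Phi> (0\<^sub>m n 0) L (0\<^sub>m k 0)"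
  define Q where "Q = four_block_mat S B (0\<^sub>m 0 n) (0\<^sub>m 0 k)"
  have P: "P \<in> carrier_mat m m" and Q: "Q \<in> carrier_mat m m"
    using \<Phi>c L Sc B m unfolding P_def Q_def by auto
  have "P * Q = 1\<^sub>m m" unfolding P_def Q_def m
    by (subst mult_four_block_mat[of _ n m _ 0 _ k _ _ n _ k])
      (use \<Phi>c L Sc B in \<open>simp_all add: \<Phi>S \<Phi>B LS LB\<close>)
  moreover have "Q * P = 1\<^sub>m m" unfolding P_def Q_def
    by (subst mult_four_block_mat[of _ m n _ k _ 0 _ _ m _ 0]) (use \<Phi>c L Sc B sum in auto)
  ultimately have "P \<in> carrier (GL m)" unfolding carrier_GL using P Q by blast
  moreover have "P * \<rho> g = direct_sum_rep n \<pi> k \<sigma> g * P" if g: "g \<in> carrier G" for g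
  proof -
    note \<rho>g = is_repD(1)[OF \<rho> g] and \<pi>g = is_repD(1)[OF \<pi> g] and \<sigma>g = is_repD(1)[OF rep\<sigma> g]
    \<comment> \<open>Empty blocks are added so that block multiplication matches the shape of
      \<open>P\<close>.\<close>
    have "\<rho> g = four_block_mat (\<rho> g) (0\<^sub>m m 0) (0\<^sub>m 0 m) (0\<^sub>m 0 0)"
      using \<rho>g by (intro eq_matI) auto
    then have "P * \<rho> g = P * four_block_mat (\<rho> g) (0\<^sub>m m 0) (0\<^sub>m 0 m) (0\<^sub>m 0 0)" by simp
    also have "\<dots> = four_block_mat (\<Phi> * \<rho> g) (0\<^sub>m n 0) (L * \<rho> g) (0\<^sub>m k 0)"
      unfolding P_def by (subst mult_four_block_mat[of _ n m _ 0 _ k _ _ m _ 0]) (use \<Phi>c L \<rho>g in auto)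
    also have "\<dots> = four_block_mat (\<pi> g * \<Phi>) (0\<^sub>m n 0) (\<sigma> g * L) (0\<^sub>m k 0)"
      unfolding \<Phi>e[OF g] \<sigma>L[OF g] by (rule refl)
    also have "\<dots> = direct_sum_rep n \<pi> k \<sigma> g * P"
      unfolding P_def direct_sum_rep_def
      by (subst mult_four_block_mat[of _ n n _ k _ k _ _ m _ 0]) (use \<Phi>c L \<pi>g \<sigma>g in auto)
    finally show ?thesis .
  qed
  ultimately show ?thesis
    unfolding direct_summand_def equivalent_reps_def using m rep\<sigma> by blast
qed

subsection \<open>Restriction from a group to a subgroup\<close>

text \<open>\<rho> is the regular representation of the finite quotient by \<open>K\<close>, as
  permutation matrices. Under Frobenius reciprocity \<Phi> corresponds to the first unit vector of
  the space of \<pi>, which exists because \<open>n\<close> is nonzero.\<close>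

lemma regular_cover:
  fixes G (structure)
  assumes K: "K \<lhd> G" and fin: "finite (rcosets K)" and H: "subgroup H G" and KH: "K \<subseteq> H"
    and \<pi>: "is_rep (G\<lparr>carrier := H\<rparr>) n \<pi>" and \<pi>K: "\<And>x. x \<in> K \<Longrightarrow> \<pi> x = 1\<^sub>m n" and n: "n \<noteq> 0"
  obtains d \<rho> \<Phi> where "is_rep G d \<rho>" "\<And>x. x \<in> K \<Longrightarrow> \<rho> x = 1\<^sub>m d"
    "intertwiner H d \<rho> n \<pi> \<Phi>" "\<Phi> \<noteq> 0\<^sub>m n d"
proof -
  interpret normal K G by fact
  interpret H: subgroup H G by fact
  have GH: "group (G\<lparr>carrier := H\<rparr>)" by (rule subgroup_imp_group[OF H])
  have HG: "x \<in> carrier G" if "x \<in> H" for x using that H.subset by blast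
  obtain d and idx :: "'a \<Rightarrow> nat" and r where idx: "\<And>x. x \<in> carrier G \<Longrightarrow> idx x < d"
    and r: "\<And>i. i < d \<Longrightarrow> r i \<in> carrier G" and idx_r: "\<And>i. i < d \<Longrightarrow> idx (r i) = i"
    and idx_eq: "\<And>x y. x \<in> carrier G \<Longrightarrow> y \<in> carrier G \<Longrightarrow> idx x = idx y \<longleftrightarrow> x \<otimes> inv y \<in> K"
    by (rule coset_indexing[OF K fin]) blast
  \<comment> \<open>Passing to the chosen representative before translating does not change the
    resulting coset; this makes \<rho> multiplicative.\<close>
  have idx_cong: "idx (g \<otimes> r (idx x)) = idx (g \<otimes> x)" if "g \<in> carrier G" "x \<in> carrier G" for g x
    using that mult_left_mod[of "r (idx x)" x g] idx r idx_r idx_eq by (metis m_closed)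
  have mod: "r (idx x) \<otimes> inv x \<in> K" if "x \<in> carrier G" for x
    using that idx r idx_r idx_eq by metis
  define \<rho> :: "'a \<Rightarrow> complex mat"
    where "\<rho> g = mat d d (\<lambda>(i, j). if idx (g \<otimes> r j) = i then 1 else 0)" for g
  define \<Phi> where "\<Phi> = mat n d (\<lambda>(i, j). if r j \<in> H then \<pi> (r j) $$ (i, 0) else 0)"
  have triv: "\<rho> x = 1\<^sub>m d" if x: "x \<in> K" for x
  proof -
    have "idx (x \<otimes> r j) = j" if j: "j < d" for j
    proof -
      have "x \<otimes> r j \<otimes> inv (r j) \<in> K" using x r[OF j] by (simp add: m_assoc)
      then show ?thesis using idx_eq[of "x \<otimes> r j" "r j"] r[OF j] idx_r[OF j] x by simp
    qed
    then show ?thesis by (intro eq_matI) (auto simp: \<rho>_def)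
  qed
  have "is_rep G d \<rho>"
  proof (rule is_repI[OF is_group])
    fix g h assume g: "g \<in> carrier G" and h: "h \<in> carrier G"
    show "\<rho> (g \<otimes> h) = \<rho> g * \<rho> h"
    proof (rule eq_matI)
      fix i j assume "i < dim_row (\<rho> g * \<rho> h)" "j < dim_col (\<rho> g * \<rho> h)"
      then have i: "i < d" and j: "j < d" by (simp_all add: \<rho>_def)
      have hj: "h \<otimes> r j \<in> carrier G" using h r[OF j] by simp
      have "(\<rho> g * \<rho> h) $$ (i, j) =
          (\<Sum>k = 0..<d. (if idx (g \<otimes> r k) = i then 1 else 0) * (if idx (h \<otimes> r j) = k then 1 else 0))"
        using i j by (simp add: \<rho>_def scalar_prod_def)
      also have "\<dots> = (if idx (g \<otimes> r (idx (h \<otimes> r j))) = i then 1 else 0)"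
        using idx[OF hj] by (subst sum.remove[of _ "idx (h \<otimes> r j)"]) auto
      also have "\<dots> = \<rho> (g \<otimes> h) $$ (i, j)"
        using i j g h r[OF j] by (simp add: \<rho>_def idx_cong[OF g hj] m_assoc)
      finally show "\<rho> (g \<otimes> h) $$ (i, j) = (\<rho> g * \<rho> h) $$ (i, j)" by simp
    qed (simp_all add: \<rho>_def)
  qed (simp_all add: triv, simp add: \<rho>_def)
  moreover have "intertwiner H d \<rho> n \<pi> \<Phi>"
    unfolding intertwiner_def
  proof (intro conjI ballI)
    show \<Phi>c: "\<Phi> \<in> carrier_mat n d" by (simp add: \<Phi>_def)
    fix h assume h: "h \<in> H"
    have \<pi>h: "\<pi> h \<in> carrier_mat n n" using is_repD(1)[OF \<pi>] h by simp
    show "\<Phi> * \<rho> h = \<pi> h * \<Phi>"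
    proof (rule eq_matI)
      fix i j assume "i < dim_row (\<pi> h * \<Phi>)" "j < dim_col (\<pi> h * \<Phi>)"
      then have i: "i < n" and j: "j < d" using \<pi>h by (simp_all add: \<Phi>_def)
      define x where "x = h \<otimes> r j"
      have x: "x \<in> carrier G" using HG[OF h] r[OF j] by (simp add: x_def)
      note rx = r[OF idx[OF x]]
      have "(\<Phi> * \<rho> h) $$ (i, j) = (\<Sum>k = 0..<d. \<Phi> $$ (i, k) * (if idx x = k then 1 else 0))"
        using i j \<Phi>c by (simp add: \<rho>_def scalar_prod_def x_def)
      also have "\<dots> = \<Phi> $$ (i, idx x)"
        using idx[OF x] by (subst sum.remove[of _ "idx x"]) auto
      also have "\<dots> = (if r (idx x) \<in> H then \<pi> (r (idx x)) $$ (i, 0) else 0)"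
        using i idx[OF x] by (simp add: \<Phi>_def)
      \<comment> \<open>Membership in \<open>H\<close> depends only on the coset because
        \<open>K\<close> lies in \<open>H\<close>, and is unaffected by left multiplication by
        \<open>h\<close>.\<close>
      also have "r (idx x) \<in> H \<longleftrightarrow> x \<in> H"
        using H.mem_iff_of_mod[OF is_group rx x] mod[OF x] KH by blast
      also have "x \<in> H \<longleftrightarrow> r j \<in> H"
      proof
        assume "x \<in> H"
        then have "inv h \<otimes> x \<in> H" using h by simp
        then show "r j \<in> H" using HG[OF h] r[OF j] by (simp add: x_def flip: m_assoc)
      qed (use h in \<open>simp add: x_def\<close>)
      also have "(if r j \<in> H then \<pi> (r (idx x)) $$ (i, 0) else 0) = (\<pi> h * \<Phi>) $$ (i, j)"
      proof (cases "r j \<in> H")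
        case True
        then have xH: "x \<in> H" using h by (simp add: x_def)
        then have rH: "r (idx x) \<in> H"
          using H.mem_iff_of_mod[OF is_group rx x] mod[OF x] KH by blast
        have "\<pi> (r (idx x)) = \<pi> x"
        proof (rule rep_eq_of_mod[OF GH \<pi>])
          show "\<pi> (r (idx x) \<otimes>\<^bsub>G\<lparr>carrier := H\<rparr>\<^esub> inv\<^bsub>G\<lparr>carrier := H\<rparr>\<^esub> x) = 1\<^sub>m n"
            using \<pi>K[OF mod[OF x]] m_inv_consistent[OF H xH] by simp
        qed (use rH xH in simp_all)
        also have "\<dots> = \<pi> h * \<pi> (r j)" using is_repD(2)[OF \<pi>] h True by (simp add: x_def)
        finally have "\<pi> (r (idx x)) $$ (i, 0) = (\<Sum>k = 0..<n. \<pi> h $$ (i, k) * \<pi> (r j) $$ (k, 0))"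
          using \<pi>h is_repD(1)[OF \<pi>, of "r j"] True i n by (simp add: scalar_prod_def)
        then show ?thesis
          using True i j \<pi>h by (simp add: \<Phi>_def scalar_prod_def)
      next
        case False
        then show ?thesis using i j \<pi>h by (simp add: \<Phi>_def scalar_prod_def)
      qed
      finally show "(\<Phi> * \<rho> h) $$ (i, j) = (\<pi> h * \<Phi>) $$ (i, j)" .
    qed (use \<Phi>c \<pi>h in \<open>simp_all add: \<rho>_def\<close>)
  qed
  moreover have "\<Phi> \<noteq> 0\<^sub>m n d"
  proof -
    \<comment> \<open>On the coset of the identity \<Phi> takes the first unit vector as its
      value.\<close>
    have rK: "r (idx \<one>) \<in> K" using mod[OF one_closed] r[OF idx[OF one_closed]] by simp
    then have "\<Phi> $$ (0, idx \<one>) = 1" using KH \<pi>K[OF rK] n idx[OF one_closed] by (auto simp: \<Phi>_def)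
    then show ?thesis using n idx[OF one_closed] by auto
  qed
  ultimately show thesis using that triv by blast
qed

text \<open>The general form of the argument: all that enters about the subgroup is that it contains
  a normal subgroup \<open>K\<close> of finite index in \<open>G\<close> acting trivially under
  \<pi>. That \<open>R\<close> is trivial on the same \<open>K\<close> later gives the congruence
  property.\<close>

theorem irreducible_rep_in_restriction:
  fixes G (structure)
  assumes K: "K \<lhd> G" and fin: "finite (rcosets K)" and H: "subgroup H G" and KH: "K \<subseteq> H"
    and irr: "irreducible_rep (G\<lparr>carrier := H\<rparr>) n \<pi>" and \<pi>K: "\<And>x. x \<in> K \<Longrightarrow> \<pi> x = 1\<^sub>m n"
  obtains m R where "irreducible_rep G m R" "\<And>x. x \<in> K \<Longrightarrow> R x = 1\<^sub>m m"
    "direct_summand (G\<lparr>carrier := H\<rparr>) n \<pi> m (restrict R H)"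
proof -
  interpret normal K G by fact
  let ?H = "G\<lparr>carrier := H\<rparr>"
  have GH: "group ?H" by (rule subgroup_imp_group[OF H])
  have HG: "H \<subseteq> carrier G" using H by (rule subgroup.subset)
  have \<pi>: "is_rep ?H n \<pi>" and n: "n \<noteq> 0" using irr by (auto simp: irreducible_rep_def)
  obtain d \<rho> \<Phi>0 where \<rho>: "is_rep G d \<rho>" "\<And>x. x \<in> K \<Longrightarrow> \<rho> x = 1\<^sub>m d"
    and \<Phi>0: "intertwiner H d \<rho> n \<pi> \<Phi>0" "\<Phi>0 \<noteq> 0\<^sub>m n d"
    using regular_cover[OF K fin H KH \<pi> \<pi>K n] by blast
  have \<pi>c: "\<pi> h \<in> carrier_mat n n" if "h \<in> H" for h using is_repD(1)[OF \<pi>] that by simp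
  obtain m R \<Phi> where R: "irreducible_rep G m R" and RK: "\<And>x. x \<in> K \<Longrightarrow> R x = 1\<^sub>m m"
    and \<Phi>: "intertwiner H m R n \<pi> \<Phi>" and nz: "\<Phi> \<noteq> 0\<^sub>m n m"
    using irreducible_cover[OF is_group \<rho> subset HG \<pi>c \<Phi>0] by blast
  let ?R = "restrict R H"
  have repR: "is_rep G m R" using R by (simp add: irreducible_rep_def)
  have rep: "is_rep ?H m ?R"
    using is_repD[OF repR] HG H is_group
    by (intro is_repI[OF GH]) (auto simp: subgroup.m_closed subgroup.one_closed)
  have \<Phi>H: "intertwiner (carrier ?H) m ?R n \<pi> \<Phi>" using \<Phi> by (simp add: intertwiner_def)
  obtain S0 where S0: "S0 \<in> carrier_mat m n" "\<Phi> * S0 = 1\<^sub>m n"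
    by (rule intertwiner_right_inverse[OF irr rep \<Phi>H nz])
  \<comment> \<open>Every coset of \<open>K\<close> in \<open>H\<close> is also a coset of
    \<open>K\<close> in \<open>G\<close>.\<close>
  have "finite (rcosets\<^bsub>?H\<^esub> K)"
    by (rule finite_subset[OF _ fin]) (use HG in \<open>auto simp: RCOSETS_def r_coset_def\<close>)
  moreover have "K \<lhd> ?H" by (rule normal_restrict_supergroup[OF H K KH])
  ultimately obtain S where "intertwiner (carrier ?H) n \<pi> m ?R S" "\<Phi> * S = 1\<^sub>m n"
    using maschke_section[of K ?H m ?R n \<pi> \<Phi> S0] rep \<pi> RK \<pi>K \<Phi>H S0 KH by (metis restrict_apply' subsetD)
  then have "direct_summand ?H n \<pi> m ?R"
    using split_intertwiner_imp_direct_summand[OF GH rep \<pi> \<Phi>H] by blast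
  then show thesis using that R RK by blast
qed

subsection \<open>The modular group\<close>

lemma group_SL2Z: "group SL2Z"
proof (rule groupI)
  fix A assume "A \<in> carrier SL2Z"
  then have A: "A \<in> carrier_mat 2 2" "det A = 1" by (auto simp: SL2Z_def)
  \<comment> \<open>The adjugate is the inverse, as the determinant is 1.\<close>
  have "det (adj_mat A) = 1"
    using det_mult[OF adj_mat(1)[OF A(1)] A(1)] adj_mat(3)[OF A(1)] A(2) by simp
  then show "\<exists>B \<in> carrier SL2Z. B \<otimes>\<^bsub>SL2Z\<^esub> A = \<one>\<^bsub>SL2Z\<^esub>"
    using adj_mat[OF A(1)] A(2) by (intro bexI[of _ "adj_mat A"]) (auto simp: SL2Z_def)
qed (auto simp: SL2Z_def det_mult intro: assoc_mult_mat)

lemma det_2_by_2: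
  fixes A :: "'a :: comm_ring_1 mat"
  assumes "A \<in> carrier_mat 2 2"
  shows "det A = A $$ (0, 0) * A $$ (1, 1) - A $$ (0, 1) * A $$ (1, 0)"
  using laplace_expansion_column[OF assms, of 0] assms
  by (simp add: numeral_2_eq_2 cofactor_def mat_delete_def det_single mult.commute)

lemma subgroup_Gamma_theta: "subgroup Gamma_theta SL2Z"
  unfolding Gamma_theta_def
proof (rule group.generate_is_subgroup[OF group_SL2Z])
  have "det (mat_of_rows_list 2 [[0, -1], [1, 0 :: int]]) = 1"
    "det (mat_of_rows_list 2 [[1, 2], [0, 1 :: int]]) = 1"
    by (subst det_2_by_2; simp add: mat_of_rows_list_def numeral_2_eq_2)+
  then show "{mat_of_rows_list 2 [[0, -1], [1, 0]], mat_of_rows_list 2 [[1, 2], [0, 1]]} \<subseteq> carrier SL2Z"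
    by (auto simp: SL2Z_def mat_of_rows_list_def)
qed

lemma map_mat_mod_mult_cong:
  fixes A B :: "int mat"
  assumes "A \<in> carrier_mat n m" "A' \<in> carrier_mat n m" "B \<in> carrier_mat m l" "B' \<in> carrier_mat m l"
    and A: "map_mat (\<lambda>a. a mod N) A = map_mat (\<lambda>a. a mod N) A'"
    and B: "map_mat (\<lambda>a. a mod N) B = map_mat (\<lambda>a. a mod N) B'"
  shows "map_mat (\<lambda>a. a mod N) (A * B) = map_mat (\<lambda>a. a mod N) (A' * B')"
proof (rule eq_matI)
  fix i j assume "i < dim_row (map_mat (\<lambda>a. a mod N) (A' * B'))" "j < dim_col (map_mat (\<lambda>a. a mod N) (A' * B'))"
  then have i: "i < n" and j: "j < l" using assms by auto
  have "A $$ (i, k) * B $$ (k, j) mod N = A' $$ (i, k) * B' $$ (k, j) mod N" if k: "k < m" for k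
    using arg_cong[OF A, of "\<lambda>M. M $$ (i, k)"] arg_cong[OF B, of "\<lambda>M. M $$ (k, j)"] assms(1-4) i j k
    by (intro mod_mult_cong) auto
  then have "(\<Sum>k = 0..<m. A $$ (i, k) * B $$ (k, j) mod N) mod N =
      (\<Sum>k = 0..<m. A' $$ (i, k) * B' $$ (k, j) mod N) mod N" by simp
  then show "map_mat (\<lambda>a. a mod N) (A * B) $$ (i, j) = map_mat (\<lambda>a. a mod N) (A' * B') $$ (i, j)"
    using assms(1-4) i j by (simp add: scalar_prod_def mod_sum_eq)
qed (use assms in auto)

text \<open>The reduction \<open>f\<close> of a product depends only on the reductions of the
  factors, so its fibre over the identity is normal. Each coset is determined by a reduced matrix,
  and for positive \<open>N\<close> there are finitely many of these.\<close>

lemma Gamma_normal: "Gamma N \<lhd> SL2Z" (is ?normal)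
  and finite_rcosets_Gamma: "N > 0 \<Longrightarrow> finite (rcosets\<^bsub>SL2Z\<^esub> (Gamma N))"
proof -
  interpret SL2Z: group SL2Z by (rule group_SL2Z)
  let ?S = "carrier SL2Z"
  define f :: "int mat \<Rightarrow> int mat" where "f = map_mat (\<lambda>a. a mod int N)"
  have Gamma: "Gamma N = {A \<in> ?S. f A = f \<one>\<^bsub>SL2Z\<^esub>}" by (simp add: Gamma_def f_def SL2Z_def)
  have cong: "f (A \<otimes>\<^bsub>SL2Z\<^esub> B) = f (A' \<otimes>\<^bsub>SL2Z\<^esub> B')"
    if "A \<in> ?S" "A' \<in> ?S" "B \<in> ?S" "B' \<in> ?S" "f A = f A'" "f B = f B'" for A A' B B'
    using that map_mat_mod_mult_cong[of A 2 2 A' B 2 B' "int N"] by (simp add: f_def SL2Z_def)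
  have "subgroup (Gamma N) SL2Z"
  proof (rule SL2Z.subgroupI)
    show "inv\<^bsub>SL2Z\<^esub> A \<in> Gamma N" if "A \<in> Gamma N" for A
      using that cong[of A "\<one>\<^bsub>SL2Z\<^esub>" "inv\<^bsub>SL2Z\<^esub> A" "inv\<^bsub>SL2Z\<^esub> A"] by (simp add: Gamma)
    show "A \<otimes>\<^bsub>SL2Z\<^esub> B \<in> Gamma N" if "A \<in> Gamma N" "B \<in> Gamma N" for A B
      using that cong[of A "\<one>\<^bsub>SL2Z\<^esub>" B "\<one>\<^bsub>SL2Z\<^esub>"] by (simp add: Gamma)
  qed (auto simp: Gamma)
  then show normal: ?normal
  proof (rule SL2Z.normal_invI)
    fix X A assume X: "X \<in> ?S" and A: "A \<in> Gamma N"
    have "f (X \<otimes>\<^bsub>SL2Z\<^esub> A) = f X" using cong[of X X A "\<one>\<^bsub>SL2Z\<^esub>"] X A by (simp add: Gamma)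
    then have "f (X \<otimes>\<^bsub>SL2Z\<^esub> A \<otimes>\<^bsub>SL2Z\<^esub> inv\<^bsub>SL2Z\<^esub> X) = f \<one>\<^bsub>SL2Z\<^esub>"
      using cong[of "X \<otimes>\<^bsub>SL2Z\<^esub> A" X "inv\<^bsub>SL2Z\<^esub> X" "inv\<^bsub>SL2Z\<^esub> X"] X A by (simp add: Gamma)
    then show "X \<otimes>\<^bsub>SL2Z\<^esub> A \<otimes>\<^bsub>SL2Z\<^esub> inv\<^bsub>SL2Z\<^esub> X \<in> Gamma N" using X A by (simp add: Gamma)
  qed
  assume N: "N > 0"
  let ?I = "{0..<2} \<times> {0..<2 :: nat}"
  have "f ` ?S \<subseteq> mat 2 2 ` (?I \<rightarrow>\<^sub>E {0..<int N})"
  proof (rule image_subsetI)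
    fix A assume "A \<in> ?S"
    then have "f A = mat 2 2 (restrict (\<lambda>ij. A $$ ij mod int N) ?I)"
      by (intro eq_matI) (auto simp: f_def SL2Z_def)
    moreover have "restrict (\<lambda>ij. A $$ ij mod int N) ?I \<in> ?I \<rightarrow>\<^sub>E {0..<int N}" using N by auto
    ultimately show "f A \<in> mat 2 2 ` (?I \<rightarrow>\<^sub>E {0..<int N})" by blast
  qed
  then have fin: "finite (f ` ?S)" by (rule finite_subset) (intro finite_imageI finite_PiE; simp)
  have eq: "Gamma N #>\<^bsub>SL2Z\<^esub> A = Gamma N #>\<^bsub>SL2Z\<^esub> B" if A: "A \<in> ?S" and B: "B \<in> ?S" and "f A = f B" for A B
  proof -
    have "A \<otimes>\<^bsub>SL2Z\<^esub> inv\<^bsub>SL2Z\<^esub> B \<in> Gamma N"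
      using cong[of A B "inv\<^bsub>SL2Z\<^esub> B" "inv\<^bsub>SL2Z\<^esub> B"] that by (simp add: Gamma)
    then have "A \<in> Gamma N #>\<^bsub>SL2Z\<^esub> B"
      by (rule subgroup.rcos_module_rev[OF normal_imp_subgroup[OF normal] group_SL2Z B A])
    then show ?thesis
      using SL2Z.repr_independence[OF _ B normal_imp_subgroup[OF normal]] by simp
  qed
  \<comment> \<open>Choosing a preimage under \<open>f\<close> recovers a coset from its
    reduction.\<close>
  have "rcosets\<^bsub>SL2Z\<^esub> (Gamma N) \<subseteq> (\<lambda>M. Gamma N #>\<^bsub>SL2Z\<^esub> inv_into ?S f M) ` f ` ?S"
  proof
    fix C assume "C \<in> rcosets\<^bsub>SL2Z\<^esub> (Gamma N)"
    then obtain A where A: "A \<in> ?S" "C = Gamma N #>\<^bsub>SL2Z\<^esub> A" by (auto simp: RCOSETS_def)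
    have "C = Gamma N #>\<^bsub>SL2Z\<^esub> inv_into ?S f (f A)"
      unfolding A(2) using A(1)
      by (intro eq) (auto intro: inv_into_into simp: f_inv_into_f)
    then show "C \<in> (\<lambda>M. Gamma N #>\<^bsub>SL2Z\<^esub> inv_into ?S f M) ` f ` ?S" using A(1) by blast
  qed
  then show "finite (rcosets\<^bsub>SL2Z\<^esub> (Gamma N))" using fin finite_subset by blast
qed

theorem mainTheorem2:
  fixes n :: nat and \<pi> :: "int mat \<Rightarrow> complex mat"
  assumes "irreducible_rep Gamma_theta_group n \<pi>"
    and "congruence_rep Gamma_theta_group n \<pi>"
  shows "\<exists>m R. irreducible_rep SL2Z m R \<and> congruence_rep SL2Z m R \<and>
    direct_summand Gamma_theta_group n \<pi> m (restrict R Gamma_theta)"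
proof -
  obtain N where N: "N > 0" and ker: "Gamma N \<subseteq> kernel Gamma_theta_group (GL n) \<pi>"
    using assms(2) by (auto simp: congruence_rep_def)
  \<comment> \<open>\<open>kernel\<close> consists of elements of the carrier, so the hypothesis
    also places Gamma(N) inside Gamma_theta.\<close>
  have sub: "Gamma N \<subseteq> Gamma_theta" and triv: "\<And>x. x \<in> Gamma N \<Longrightarrow> \<pi> x = 1\<^sub>m n"
    using ker by (auto simp: kernel_def Gamma_theta_group_def one_GL)
  obtain m R where R: "irreducible_rep SL2Z m R" and RN: "\<And>x. x \<in> Gamma N \<Longrightarrow> R x = 1\<^sub>m m"
    and sum: "direct_summand Gamma_theta_group n \<pi> m (restrict R Gamma_theta)"
    using irreducible_rep_in_restriction[OF Gamma_normal finite_rcosets_Gamma[OF N] subgroup_Gamma_theta sub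
        assms(1)[unfolded Gamma_theta_group_def] triv]
    unfolding Gamma_theta_group_def by blast
  have "congruence_rep SL2Z m R"
    using R RN N unfolding congruence_rep_def irreducible_rep_def
    by (auto simp: kernel_def one_GL Gamma_def)
  then show ?thesis using R sum by blast
qed

end
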